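(* Assume the following (unproved) statement (C): for all positive rational numbers $a,p$ with $a<p$ and every positive rational $r$, with $q=e^{-\pi\sqrt r}$, the number $q^{\frac{p}{12}-\frac a2+\frac{a^2}{2p}}\,[a,p;q]$ is algebraic. Let $f$ be a function analytic in $(-1,1)$, and set $$X(n)=\frac1n\sum_{d\mid n}\frac{f^{(d)}(0)}{\Gamma(d)}\,\mu\!\left(\frac nd\right).$$ If $X(n)$ is a $T$-periodic sequence, rational valued and catoptric in every period-interval, then there exists a rational number $A$ such that $$q^{A}e^{-f(q)}=\text{algebraic number}$$ at the points $q=e^{-\pi\sqrt r}$, $r$ positive rational. The number $A$ is given by $$A=\sum_{j=1}^{\left[\frac{T-1}{2}\right]}\left(-\frac j2+\frac{j^2}{2T}+\frac T{12}\right)X(j).$$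
   Context: For positive rationals $a<p$ and $q=e^{-\pi\sqrt r}$, $r>0$, the "agile" is $[a,p;q]:=\prod_{n=0}^{\infty}(1-q^{pn+a})(1-q^{pn+p-a})$. $\mu$ is the Moebius function, $\Gamma$ is the Gamma function ($\Gamma(d)=(d-1)!$), and $[x]$ in a summation limit is the integer part of $x$. A $T$-periodic sequence $X$, with $a_k=X(k+nT)=X(k)$ for every $n\in\mathbb N$, is called catoptric in every period-interval if $a_T=0$ and $a_1=a_{T-1},\ a_2=a_{T-2},\ \ldots,\ a_{(T-1)/2}=a_{(T+1)/2}$.
   Formalization: Adds that e^{f(0)} is algebraic (f=1 gives X=0, A=0 and 1/e otherwise). For even T the middle value X(T/2) is free; a rational A is still shown to exist, but its formula is claimed only if X(T/2)=0, since otherwise a term -T X(T/2)/48 is missing. *)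

theory Defs
  imports
    "HOL-Analysis.Analysis"
    "HOL-Computational_Algebra.Computational_Algebra"
begin

definition nome :: "real \<Rightarrow> real" where
  "nome r = exp (- pi * sqrt r)"

definition agile :: "real \<Rightarrow> real \<Rightarrow> real \<Rightarrow> real" where
  "agile a p q =
     (\<Prod>n. (1 - q powr (p * real n + a)) * (1 - q powr (p * real n + p - a)))"

definition moebius :: "nat \<Rightarrow> int" where
  "moebius n = (if squarefree n then (- 1) ^ card (prime_factors n) else 0)"

(* Real-analyticity: a local power series at every point of S, with no lower bound on
   its radius of convergence. *)
definition real_analytic_on :: "(real \<Rightarrow> real) \<Rightarrow> real set \<Rightarrow> bool" where
  "real_analytic_on f S \<longleftrightarrow> (\<forall>x\<in>S. \<exists>F. (\<lambda>h. f (x + h)) has_fps_expansion F)"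

(* Only the values at n \<ge> 1 are meaningful. *)
definition X :: "(real \<Rightarrow> real) \<Rightarrow> nat \<Rightarrow> real" where
  "X f n = 1 / real n *
     (\<Sum>d | d dvd n. (deriv ^^ d) f 0 / Gamma (real d) * real_of_int (moebius (n div d)))"

(* Sequences are indexed by k \<ge> 1, and T is a period, not necessarily the least one. *)
definition periodic_seq :: "nat \<Rightarrow> (nat \<Rightarrow> real) \<Rightarrow> bool" where
  "periodic_seq T a \<longleftrightarrow> T > 0 \<and> (\<forall>k\<ge>1. \<forall>n. a (k + n * T) = a k)"

(* For odd T the last mirrored pair is ((T - 1) / 2, (T + 1) / 2). For even T it is
   (T / 2 - 1, T / 2 + 1), and the self-paired middle value a (T / 2) is unconstrained.
   The notion is only meant for sequences with periodic_seq T a, for which the condition on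
   one period yields the mirror symmetry in every period. *)
definition catoptric :: "nat \<Rightarrow> (nat \<Rightarrow> real) \<Rightarrow> bool" where
  "catoptric T a \<longleftrightarrow> a T = 0 \<and> (\<forall>j\<in>{1..(T - 1) div 2}. a j = a (T - j))"

end

theory Submission
  imports Defs "HOL-Complex_Analysis.Cauchy_Integral_Formula"
begin

text \<open>
  Why the theorem holds. Write \<open>c\<^sub>n\<close> for the Taylor coefficients of \<open>f\<close> at 0. Since
  \<open>f\<^sup>(\<^sup>d\<^sup>)(0) / \<Gamma>(d) = d c\<^sub>d\<close>, the definition of \<open>X\<close> says that \<open>n X(n)\<close> is the Dirichlet convolution
  of \<open>d c\<^sub>d\<close> with the Moebius function, so Moebius inversion gives
  \<open>n c\<^sub>n = \<Sum>\<^sub>d\<^sub>|\<^sub>n d X(d)\<close> (\<open>taylor_coeff_divisor_sum\<close>). A periodic \<open>X\<close> is bounded, hence the Taylor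
  series converges on the whole unit interval, and by the identity theorem for real-analytic
  functions it represents \<open>f\<close> on all of (-1,1), not only near 0 (\<open>real_analytic_eq_eval_fps\<close>).
  Rearranging the absolutely convergent double series over the pairs (d, n/d) turns it into
  \<open>f(q) - f(0) = - \<Sum>\<^sub>d X(d) ln (1 - q\<^sup>d)\<close> (\<open>lambert_log_sums\<close>).

  Collecting the exponents d by their residue j modulo T, and pairing j with T - j by the mirror
  symmetry, gives \<open>exp (- f(q)) = exp (- f(0)) \<Prod>\<^sub>0\<^sub><\<^sub>j\<^sub><\<^sub>T [j,T;q]\<^bsup>X(j)/2\<^esup>\<close>
  (\<open>exp_minus_eq_prod_agile\<close>). Taking the product over all j with half exponents, instead of half the
  j with full exponents, covers even T without a separate treatment of the self-paired j = T/2.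
  By hypothesis each agile becomes algebraic after multiplication with its power of q; algebraic
  numbers are closed under products (\<open>algebraic_times\<close>) and rational powers
  (\<open>algebraic_powr_Rats\<close>), and \<open>exp (- f(0))\<close> is the inverse of a number assumed algebraic.
  So A is the sum of these exponents of q weighted by \<open>X(j)/2\<close>. The stated formula folds this
  symmetric sum onto j < T/2, which is exact once \<open>X(T/2) = 0\<close> for even T.
\<close>

section \<open>Algebraic numbers\<close>

text \<open>
  A rational polynomial relation lets every high power of a be expressed by the m powers just
  below it. In this form it serves directly as the induction step that reduces exponents.
\<close>
lemma algebraic_power_recurrence:
  fixes a :: "'a :: field_char_0"
  assumes "algebraic a"
  obtains m :: nat and r :: "nat \<Rightarrow> rat"
    where "\<And>k. k \<ge> m \<Longrightarrow> a ^ k = (\<Sum>i<m. of_rat (r i) * a ^ (k - m + i))"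
proof -
  from assms obtain p where p: "\<forall>i. coeff p i \<in> \<rat>" "p \<noteq> 0" "poly p a = 0"
    by (auto simp: algebraic_altdef)
  define m where "m = degree p"
  have lc: "coeff p m \<noteq> 0"
    using p(2) by (simp add: m_def)
  have "\<forall>i. \<exists>q. - coeff p i / coeff p m = of_rat q"
  proof
    fix i
    have "- coeff p i / coeff p m \<in> \<rat>"
      using p(1) by (intro Rats_divide) auto
    thus "\<exists>q. - coeff p i / coeff p m = of_rat q"
      by (rule Rats_cases) blast
  qed
  then obtain r where r: "\<And>i. - coeff p i / coeff p m = of_rat (r i)"
    by metis
  have "poly p a = (\<Sum>i<m. coeff p i * a ^ i) + coeff p m * a ^ m"
    by (simp add: poly_altdef m_def lessThan_Suc_atMost [symmetric])
  with p(3) have "coeff p m * a ^ m = - (\<Sum>i<m. coeff p i * a ^ i)"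
    by (simp add: add_eq_0_iff)
  hence "a ^ m = - (\<Sum>i<m. coeff p i * a ^ i) / coeff p m"
    using lc by (simp add: field_simps)
  also have "\<dots> = (\<Sum>i<m. of_rat (r i) * a ^ i)"
    by (simp add: r [symmetric] sum_divide_distrib sum_negf)
  finally have eq: "a ^ m = (\<Sum>i<m. of_rat (r i) * a ^ i)" .
  show ?thesis
  proof (rule that)
    fix k assume "k \<ge> m"
    hence "a ^ k = a ^ (k - m) * a ^ m"
      by (simp flip: power_add)
    also have "\<dots> = (\<Sum>i<m. of_rat (r i) * a ^ (k - m + i))"
      unfolding eq by (simp add: sum_distrib_left power_add mult_ac)
    finally show "a ^ k = (\<Sum>i<m. of_rat (r i) * a ^ (k - m + i))" .
  qed
qed

text \<open>
  If all powers of c live in a rational vector space with finitely many generators, then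
  sufficiently many of them are linearly dependent, and a dependency between powers is a
  polynomial equation for c. The case of two coinciding powers is separate because the set of
  powers is then too small for the dimension count.
\<close>
lemma algebraic_if_powers_in_fin_dim:
  fixes c :: "'a :: field_char_0"
  defines "scl \<equiv> (\<lambda>(q::rat) (x::'a). of_rat q * x)"
  assumes fin: "finite B" and span: "\<And>k::nat. c ^ k \<in> module.span scl B"
  shows "algebraic c"
proof -
  interpret vector_space scl
    by unfold_locales (auto simp: scl_def algebra_simps of_rat_add of_rat_mult)
  define N where "N = card B"
  show ?thesis
  proof (cases "inj_on (\<lambda>k. c ^ k) {..N}")
    case True
    let ?S = "(\<lambda>k. c ^ k) ` {..N}"
    have "card ?S = Suc N"
      using True by (simp add: card_image)
    hence "\<not> independent ?S"
      using independent_span_bound[OF fin, of ?S] span by (auto simp: N_def)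
    then obtain u v where u: "v \<in> ?S" "u v \<noteq> 0" "(\<Sum>v\<in>?S. scl (u v) v) = 0"
      using dependent_finite[of ?S] by auto
    define p :: "'a poly" where "p = (\<Sum>k\<le>N. monom (of_rat (u (c ^ k))) k)"
    have cf: "coeff p i = (if i \<le> N then of_rat (u (c ^ i)) else 0)" for i
      by (simp add: p_def coeff_sum)
    show ?thesis
    proof (rule algebraicI')
      show "coeff p i \<in> \<rat>" for i
        by (simp add: cf)
      from u(1) obtain k where k: "k \<le> N" "v = c ^ k"
        by blast
      hence "coeff p k \<noteq> 0"
        using u(2) by (simp add: cf)
      thus "p \<noteq> 0"
        by auto
      have "poly p c = (\<Sum>k\<le>N. scl (u (c ^ k)) (c ^ k))"
        by (simp add: p_def poly_sum poly_monom scl_def)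
      also have "\<dots> = 0"
        using u(3) by (simp add: sum.reindex[OF True])
      finally show "poly p c = 0" .
    qed
  next
    case False
    then obtain k l where kl: "k \<noteq> l" "c ^ k = c ^ l"
      by (auto simp: inj_on_def)
    show ?thesis
    proof (rule algebraicI')
      show "coeff (monom 1 k - monom 1 l :: 'a poly) i \<in> \<rat>" for i
        by auto
      show "monom 1 k - monom 1 l \<noteq> (0 :: 'a poly)"
        using kl(1) by (simp add: poly_eq_iff) (metis one_neq_zero)
      show "poly (monom 1 k - monom 1 l) c = 0"
        using kl(2) by (simp add: poly_monom)
    qed
  qed
qed

text \<open>
  The monomials \<open>a\<^sup>i b\<^sup>j\<close> with i, j below the degrees of a and b span all such monomials, among
  them the powers of ab. Exponents of a are reduced first, then those of b.
\<close>
lemma algebraic_times: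
  fixes a b :: "'a :: field_char_0"
  assumes "algebraic a" "algebraic b"
  shows "algebraic (a * b)"
proof -
  define scl where "scl = (\<lambda>(q::rat) (x::'a). of_rat q * x)"
  interpret vector_space scl
    by unfold_locales (auto simp: scl_def algebra_simps of_rat_add of_rat_mult)
  from algebraic_power_recurrence[OF assms(1)] obtain m r
    where a: "\<And>k. k \<ge> m \<Longrightarrow> a ^ k = (\<Sum>i<m. of_rat (r i) * a ^ (k - m + i))" by metis
  from algebraic_power_recurrence[OF assms(2)] obtain n s
    where b: "\<And>k. k \<ge> n \<Longrightarrow> b ^ k = (\<Sum>i<n. of_rat (s i) * b ^ (k - n + i))" by metis
  define B where "B = (\<lambda>(i, j). a ^ i * b ^ j) ` ({..<m} \<times> {..<n})"
  have small: "a ^ k * b ^ j \<in> span B" if "j < n" for k j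
  proof (induction k rule: less_induct)
    case (less k)
    show ?case
    proof (cases "k < m")
      case True
      thus ?thesis using that by (intro span_base) (auto simp: B_def)
    next
      case False
      hence "a ^ k * b ^ j = (\<Sum>i<m. scl (r i) (a ^ (k - m + i) * b ^ j))"
        by (subst a) (auto simp: scl_def sum_distrib_left sum_distrib_right mult_ac)
      also have "\<dots> \<in> span B"
        using False by (intro span_sum span_scale less) auto
      finally show ?thesis .
    qed
  qed
  have all: "a ^ k * b ^ j \<in> span B" for k j
  proof (induction j rule: less_induct)
    case (less j)
    show ?case
    proof (cases "j < n")
      case False
      hence "a ^ k * b ^ j = (\<Sum>i<n. scl (s i) (a ^ k * b ^ (j - n + i)))"
        by (subst b) (auto simp: scl_def sum_distrib_left sum_distrib_right mult_ac)
      also have "\<dots> \<in> span B"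
        using False by (intro span_sum span_scale less) auto
      finally show ?thesis .
    qed (rule small)
  qed
  show ?thesis
  proof (rule algebraic_if_powers_in_fin_dim)
    show "finite B" by (simp add: B_def)
    show "(a * b) ^ k \<in> module.span (\<lambda>q x. of_rat q * x) B" for k
      using all[of k k] by (simp add: power_mult_distrib scl_def)
  qed
qed

lemma algebraic_prod:
  "(\<And>i. i \<in> I \<Longrightarrow> algebraic (g i)) \<Longrightarrow> algebraic (\<Prod>i\<in>I. g i :: 'a :: field_char_0)"
  by (induction I rule: infinite_finite_induct) (auto intro: algebraic_times)

lemma algebraic_powr_Rats:
  fixes x y :: real
  assumes x: "algebraic x" "x > 0" and y: "y \<in> \<rat>"
  shows "algebraic (x powr y)"
proof -
  have nat: "algebraic (x powr (real a / real b))" if "b > 0" for a b :: nat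
  proof -
    have "x powr (real a / real b) = root b (x ^ a)"
      using that x by (simp add: root_powr_inverse powr_powr flip: powr_realpow)
    moreover have "algebraic (\<Prod>i<a. x)"
      using x by (intro algebraic_prod)
    ultimately show ?thesis by auto
  qed
  from y obtain a b where ab: "b > 0" "\<bar>y\<bar> = real a / real b"
    by (metis Rats_abs_nat_div_natE neq0_conv)
  show ?thesis
  proof (cases "y \<ge> 0")
    case True
    thus ?thesis using nat[OF ab(1), of a] ab(2) by simp
  next
    case False
    hence "y = - (real a / real b)"
      using ab(2) by linarith
    hence "x powr y = inverse (x powr (real a / real b))"
      by (simp only: powr_minus)
    thus ?thesis using nat[OF ab(1), of a] by auto
  qed
qed

section \<open>Moebius inversion\<close>

lemma moebius_prime_times:
  assumes p: "prime p" and d: "\<not> p dvd d"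
  shows "moebius (p * d) = - moebius d"
proof -
  have cop: "coprime p d"
    using p d by (rule prime_imp_coprime)
  have "d \<noteq> 0" "p \<noteq> 0" using d p by (auto intro: ccontr)
  hence pf: "prime_factors (p * d) = insert p (prime_factors d)"
    using p by (simp add: prime_factors_product prime_factorization_prime)
  have "squarefree (p * d) \<longleftrightarrow> squarefree d"
    using cop p by (meson squarefree_mult_coprime squarefree_multD squarefree_prime)
  moreover have "p \<notin> prime_factors d"
    using d by auto
  ultimately show ?thesis
    by (simp add: moebius_def pf)
qed

text \<open>
  For a prime p dividing n, multiplication by p pairs the squarefree divisors of n prime to p with
  those divisible by p, and it reverses the sign of the Moebius function.
\<close>
lemma sum_moebius_divisors:
  assumes n: "n > 0"
  shows "(\<Sum>d | d dvd n. moebius d) = (if n = 1 then 1 else 0)"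
proof (cases "n = 1")
  case True
  thus ?thesis by (simp add: moebius_def)
next
  case False
  then obtain p where p: "prime p" "p dvd n"
    using prime_factor_nat by blast
  define D0 where "D0 = {d. d dvd n \<and> squarefree d \<and> \<not> p dvd d}"
  define D1 where "D1 = {d. d dvd n \<and> squarefree d \<and> p dvd d}"
  have fin: "finite {d. d dvd n}" using n by simp
  have "(\<Sum>d | d dvd n. moebius d) = sum moebius (D0 \<union> D1)"
    by (rule sum.mono_neutral_right[OF fin]) (auto simp: D0_def D1_def moebius_def)
  also have "\<dots> = sum moebius D0 + sum moebius D1"
    by (rule sum.union_disjoint) (auto simp: D0_def D1_def intro: finite_subset[OF _ fin])
  also have "sum moebius D1 = (\<Sum>d\<in>D0. moebius (p * d))"
  proof (rule sum.reindex_bij_witness[of _ "\<lambda>d. p * d" "\<lambda>d. d div p"])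
    fix d assume d: "d \<in> D1"
    then obtain e where e: "d = p * e" by (auto simp: D1_def)
    have "\<not> p dvd e"
    proof
      assume "p dvd e"
      hence "p ^ 2 dvd d" by (simp add: e power2_eq_square)
      with d p(1) show False by (auto simp: D1_def dest: squarefreeD)
    qed
    moreover have "e dvd n" "squarefree e"
      using d squarefree_multD(2)[of p e] by (auto simp: D1_def e dest: dvd_mult_right)
    moreover have "p > 0" using p(1) prime_gt_0_nat by blast
    ultimately show "p * (d div p) = d" "d div p \<in> D0" "moebius (p * (d div p)) = moebius d"
      by (simp_all add: e D0_def)
  next
    fix d assume d: "d \<in> D0"
    hence cop: "coprime p d"
      using p(1) by (auto simp: D0_def intro: prime_imp_coprime)
    show "p * d div p = d" using p(1) by auto
    show "p * d \<in> D1"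
      using d p cop by (auto simp: D0_def D1_def intro: divides_mult squarefree_mult_coprime squarefree_prime)
  qed
  also have "\<dots> = - sum moebius D0"
    using p(1) by (simp add: moebius_prime_times D0_def sum_negf)
  finally show ?thesis using False by simp
qed

text \<open>
  Exchanging the sums over d and e in e | d | n leaves for each e the sum of the Moebius
  function over the divisors of n/e, which vanishes unless e = n.
\<close>
lemma moebius_inversion:
  fixes g h :: "nat \<Rightarrow> real"
  assumes g: "\<And>m. m > 0 \<Longrightarrow> g m = (\<Sum>e | e dvd m. h e * of_int (moebius (m div e)))"
    and n: "n > 0"
  shows "h n = (\<Sum>d | d dvd n. g d)"
proof -
  have fin: "finite {d. d dvd m}" if "m > 0" for m :: nat using that by simp
  have pos: "d > 0" if "d dvd n" for d using that n by (auto intro: dvd_pos_nat)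
  have "(\<Sum>d | d dvd n. g d) =
          (\<Sum>d | d dvd n. \<Sum>e | e dvd d. h e * of_int (moebius (d div e)))"
    by (intro sum.cong) (auto simp: g pos)
  also have "\<dots> = (\<Sum>(d, e)\<in>(SIGMA d:{d. d dvd n}. {e. e dvd d}). h e * of_int (moebius (d div e)))"
    using n pos by (subst sum.Sigma) (auto simp: fin)
  also have "\<dots> = (\<Sum>(e, k)\<in>(SIGMA e:{e. e dvd n}. {k. k dvd n div e}). h e * of_int (moebius k))"
    by (rule sum.reindex_bij_witness[of _ "\<lambda>(e, k). (e * k, e)" "\<lambda>(d, e). (e, d div e)"])
       (use n pos in \<open>force elim!: dvdE simp: mult_ac\<close>)+
  also have "\<dots> = (\<Sum>e | e dvd n. \<Sum>k | k dvd n div e. h e * of_int (moebius k))"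
    using n by (subst sum.Sigma) (auto simp: dvd_div_eq_0_iff)
  also have "\<dots> = (\<Sum>e | e dvd n. h e * of_int (\<Sum>k | k dvd n div e. moebius k))"
    by (simp add: sum_distrib_left)
  also have "\<dots> = (\<Sum>e | e dvd n. if e = n then h n else 0)"
  proof (intro sum.cong refl)
    fix e assume "e \<in> {e. e dvd n}"
    then obtain k where k: "n = e * k" by auto
    hence "e > 0" "k > 0" using n by auto
    thus "h e * of_int (\<Sum>k | k dvd n div e. moebius k) = (if e = n then h n else 0)"
      using sum_moebius_divisors[of k] by (cases "k = 1") (simp_all add: k)
  qed
  also have "\<dots> = h n" using n by (simp add: sum.delta)
  finally show ?thesis by simp
qed

section \<open>Lambert series as sums of logarithms\<close>

lemma ln_one_minus_bound:
  fixes x c :: real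
  assumes "0 \<le> x" "x \<le> c" "c < 1"
  shows "\<bar>ln (1 - x)\<bar> \<le> x / (1 - c)"
proof -
  have x: "0 \<le> x" "x < 1" using assms by auto
  have "- ln (1 - x) = ln (1 / (1 - x))"
    using x by (simp add: ln_div)
  also have "\<dots> \<le> 1 / (1 - x) - 1"
    using x by (intro ln_le_minus_one) auto
  also have "\<dots> = x / (1 - x)"
    using x by (simp add: field_simps)
  also have "\<dots> \<le> x / (1 - c)"
    using assms by (intro divide_left_mono) auto
  finally show ?thesis using x by simp
qed

text \<open>
  The index set starts at 1 to match the pairs (d, k) with dk = n. The term k = 0 of the usual
  logarithm series is a division by zero with value 0, so dropping it does not change the sum.
\<close>
lemma has_sum_log_series:
  fixes x :: real
  assumes "0 \<le> x" "x < 1"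
  shows "((\<lambda>k. x ^ k / real k) has_sum - ln (1 - x)) {1..}"
proof -
  have "(\<lambda>n. - ((- (- x)) ^ n) / of_nat n) sums ln (1 + (- x))"
    using assms by (intro ln_series') auto
  from sums_minus[OF this] have "(\<lambda>n. x ^ n / real n) sums - ln (1 - x)"
    by simp
  hence "((\<lambda>n. x ^ n / real n) has_sum - ln (1 - x)) UNIV"
    using assms by (intro sums_nonneg_imp_has_sum) auto
  also have "?this \<longleftrightarrow> ?thesis"
    by (rule has_sum_cong_neutral) (auto simp: not_le)
  finally show ?thesis .
qed

lemma has_sum_Suc_iff:
  "((\<lambda>n. g (Suc n)) has_sum s) UNIV \<longleftrightarrow> (g has_sum s) {1..}"
  by (rule has_sum_reindex_bij_witness[of _ "\<lambda>n. n - 1" Suc]) auto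

lemma has_sum_geometric_atLeast1:
  fixes q :: real
  assumes "0 < q" "q < 1"
  shows "((\<lambda>k. q ^ k) has_sum q / (1 - q)) {1..}"
proof -
  have "(\<lambda>n. q * q ^ n) sums (q * (1 / (1 - q)))"
    using assms by (intro sums_mult geometric_sums) auto
  hence "((\<lambda>n. q ^ Suc n) has_sum q / (1 - q)) UNIV"
    using assms by (intro sums_nonneg_imp_has_sum) auto
  thus ?thesis
    by (simp only: has_sum_Suc_iff)
qed

text \<open>
  Absolute convergence of the double series follows from \<open>dk \<ge> d + k - 1\<close>, which bounds it by a
  product of two geometric series.
\<close>
lemma lambert_summable:
  fixes a :: "nat \<Rightarrow> real" and q :: real
  assumes q: "0 < q" "q < 1" and M: "\<And>d. d \<ge> 1 \<Longrightarrow> \<bar>a d\<bar> \<le> M"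
  shows "(\<lambda>(d, k). a d * q ^ (d * k) / real k) summable_on {1..} \<times> {1..}"
proof -
  have M0: "M \<ge> 0" using M[of 1] by simp
  have "((\<lambda>(d, k). M / q * (q ^ d * q ^ k)) summable_on {1..} \<times> {1..})"
  proof (rule summable_on_SigmaI)
    show "((\<lambda>k. case (d, k) of (d, k) \<Rightarrow> M / q * (q ^ d * q ^ k)) has_sum
            M / q * (q ^ d * (q / (1 - q)))) {1..}" for d
      unfolding prod.case by (intro has_sum_cmult_right has_sum_geometric_atLeast1 q)
    have "(\<lambda>d. M / q * (q / (1 - q)) * q ^ d) summable_on {1..}"
      using has_sum_imp_summable[OF has_sum_geometric_atLeast1[OF q]]
      by (rule summable_on_cmult_right)
    thus "(\<lambda>d. M / q * (q ^ d * (q / (1 - q)))) summable_on {1..}"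
      by (simp only: mult_ac)
  qed (use M0 q in auto)
  hence "(\<lambda>z. norm (case z of (d, k) \<Rightarrow> M / q * (q ^ d * q ^ k))) summable_on {1..} \<times> {1..}"
    by (rule summable_on_iff_abs_summable_on_real[THEN iffD1])
  hence "(\<lambda>z. norm (case z of (d, k) \<Rightarrow> a d * q ^ (d * k) / real k)) summable_on {1..} \<times> {1..}"
  proof (rule Infinite_Sum.abs_summable_on_comparison_test)
    fix z :: "nat \<times> nat"
    assume z: "z \<in> {1..} \<times> {1..}"
    obtain d k where dk: "z = (Suc d, Suc k)"
      using z by (cases z; cases "fst z"; cases "snd z") auto
    have "q ^ (Suc d * Suc k) \<le> q ^ (d + Suc k)"
      using q by (intro power_decreasing) auto
    hence "q ^ (Suc d * Suc k) / real (Suc k) \<le> q ^ (d + Suc k) / 1"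
      using q by (intro frac_le) auto
    hence "\<bar>a (Suc d)\<bar> * (q ^ (Suc d * Suc k) / real (Suc k)) \<le> M * q ^ (d + Suc k)"
      using M[of "Suc d"] M0 q by (intro mult_mono) auto
    thus "norm (case z of (d, k) \<Rightarrow> a d * q ^ (d * k) / real k)
        \<le> norm (case z of (d, k) \<Rightarrow> M / q * (q ^ d * q ^ k))"
      using M0 q by (simp add: dk abs_mult power_add mult_ac del: of_nat_Suc mult_Suc mult_Suc_right)
  qed
  thus ?thesis
    by (rule abs_summable_summable)
qed

text \<open>
  Both series are iterated sums of the one double family \<open>a(d) q\<^sup>d\<^sup>k / k\<close>: summing over k first
  produces logarithms, and collecting the pairs with dk = n produces the coefficients c.
\<close>
lemma lambert_log_sums:
  fixes a c :: "nat \<Rightarrow> real" and q :: real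
  assumes q: "0 < q" "q < 1" and M: "\<And>d. d \<ge> 1 \<Longrightarrow> \<bar>a d\<bar> \<le> M"
    and c: "\<And>n. n \<ge> 1 \<Longrightarrow> real n * c n = (\<Sum>d | d dvd n. real d * a d)"
  obtains s where "(\<lambda>n. c (Suc n) * q ^ Suc n) sums s"
    and "(\<lambda>n. a (Suc n) * ln (1 - q ^ Suc n)) sums - s"
proof -
  define F where "F = (\<lambda>(d, k). a d * q ^ (d * k) / real k)"
  obtain s where s: "(F has_sum s) ({1..} \<times> {1..})"
    using lambert_summable[of q a M, OF q M] unfolding F_def summable_on_def by blast
  have "((\<lambda>d. a d * - ln (1 - q ^ d)) has_sum s) {1..}"
  proof (rule has_sum_SigmaD[OF s])
    fix d :: nat assume "d \<in> {1..}"
    hence "((\<lambda>k. (q ^ d) ^ k / real k) has_sum - ln (1 - q ^ d)) {1..}"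
      using q by (intro has_sum_log_series) (auto simp: power_less_one_iff)
    from has_sum_cmult_right[OF this, of "a d"]
    show "((\<lambda>k. F (d, k)) has_sum a d * - ln (1 - q ^ d)) {1..}"
      by (simp add: F_def power_mult)
  qed
  hence "((\<lambda>n. a (Suc n) * - ln (1 - q ^ Suc n)) has_sum s) UNIV"
    by (subst has_sum_Suc_iff)
  from sums_minus[OF has_sum_imp_sums[OF this]]
  have 1: "(\<lambda>n. a (Suc n) * ln (1 - q ^ Suc n)) sums - s"
    by simp
  have "((\<lambda>(n, d). F (d, n div d)) has_sum s) (SIGMA n:{1..}. {d. d dvd n})"
    by (rule has_sum_reindex_bij_witness
          [of _ "\<lambda>(d, k). (d * k, d)" "\<lambda>(n, d). (d, n div d)", THEN iffD2, OF _ _ _ _ _ _ s])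
       (auto simp: Suc_le_eq dvd_div_eq_0_iff intro: dvd_pos_nat elim!: dvdE)
  hence "((\<lambda>n. \<Sum>d | d dvd n. F (d, n div d)) has_sum s) {1..}"
    by (rule has_sum_SigmaD) (auto intro!: has_sum_finite)
  also have "?this \<longleftrightarrow> ((\<lambda>n. c n * q ^ n) has_sum s) {1..}"
  proof (rule has_sum_cong)
    fix n :: nat assume n: "n \<in> {1..}"
    have "(\<Sum>d | d dvd n. F (d, n div d)) = (\<Sum>d | d dvd n. real d * a d) * (q ^ n / real n)"
      unfolding sum_distrib_right using n
      by (intro sum.cong) (auto simp: F_def elim!: dvdE)
    also have "\<dots> = c n * q ^ n"
      using n c[of n, symmetric] by simp
    finally show "(\<Sum>d | d dvd n. F (d, n div d)) = c n * q ^ n" .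
  qed
  finally have "((\<lambda>n. c (Suc n) * q ^ Suc n) has_sum s) UNIV"
    by (subst has_sum_Suc_iff)
  hence 2: "(\<lambda>n. c (Suc n) * q ^ Suc n) sums s"
    by (rule has_sum_imp_sums)
  show ?thesis by (rule that[OF 2 1])
qed

section \<open>Identity theorem for real-analytic functions\<close>

text \<open>
  Dividing off the leading power of h leaves a power series with nonzero constant term, which by
  continuity does not vanish near 0.
\<close>
lemma fps_expansion_isolated_zeros:
  fixes g :: "real \<Rightarrow> real"
  assumes "(\<lambda>h. g (x + h)) has_fps_expansion F" "F \<noteq> 0"
  shows "eventually (\<lambda>y. g y \<noteq> 0) (at x)"
proof -
  define k where "k = subdegree F"
  define G where "G = fps_shift k F"
  have rad: "fps_conv_radius F > 0" and ev: "\<forall>\<^sub>F h in nhds 0. eval_fps F h = g (x + h)"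
    using assms(1) by (auto simp: has_fps_expansion_def)
  have "isCont (eval_fps G) 0"
    using rad by (intro continuous_eval_fps) (simp add: G_def zero_ereal_def)
  moreover have "eval_fps G 0 \<noteq> 0"
    using assms(2) by (simp add: G_def k_def eval_fps_at_0)
  ultimately have "\<forall>\<^sub>F h in at 0. eval_fps G h \<noteq> 0"
    by (auto simp: isCont_def intro: tendsto_imp_eventually_ne)
  moreover have "\<forall>\<^sub>F h in at 0. h \<in> eball 0 (fps_conv_radius F) - {0}"
    using rad by (intro eventually_at_in_open) (auto simp: zero_ereal_def)
  moreover have "\<forall>\<^sub>F h in at 0. eval_fps F h = g (x + h)"
    using ev by (simp add: eventually_nhds_conv_at)
  ultimately have "\<forall>\<^sub>F h in at 0. g (x + h) \<noteq> 0"
  proof eventually_elim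
    case (elim h)
    hence "eval_fps G h = g (x + h) / h ^ k"
      unfolding G_def by (subst eval_fps_shift) (auto simp: k_def)
    with elim show ?case by auto
  qed
  thus ?thesis
    by (subst at_to_0) (simp add: eventually_filtermap add.commute)
qed

text \<open>
  The points near which g vanishes identically and the points near which g has no zero (except
  possibly at the point itself) form two disjoint open sets, which cover S because zeros are
  isolated; connectedness leaves only one of them.
\<close>
lemma real_analytic_identity:
  assumes ana: "real_analytic_on g S" and S: "connected S" "x0 \<in> S" "x \<in> S"
    and zero: "eventually (\<lambda>y. g y = 0) (nhds x0)"
  shows "g x = 0"
proof -
  define U where "U = {y. eventually (\<lambda>z. g z = 0) (nhds y)}"
  define V where "V = {y. eventually (\<lambda>z. g z \<noteq> 0) (at y)}"
  have "open U"
    by (subst open_subopen) (auto simp: U_def eventually_nhds)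
  moreover have "open V"
    unfolding open_subopen[of V]
  proof
    fix y assume "y \<in> V"
    then obtain A where A: "open A" "y \<in> A" "\<And>z. z \<in> A \<Longrightarrow> z \<noteq> y \<Longrightarrow> g z \<noteq> 0"
      by (auto simp: V_def eventually_at_topological)
    have "A \<subseteq> V"
    proof
      fix z assume z: "z \<in> A"
      have "\<forall>\<^sub>F w in at z. w \<in> A - {z}"
        using A(1) z by (intro eventually_at_in_open)
      moreover have "\<forall>\<^sub>F w in at z. w \<noteq> y"
        by (rule eventually_neq_at_within)
      ultimately have "\<forall>\<^sub>F w in at z. g w \<noteq> 0"
        by eventually_elim (use A(3) in auto)
      thus "z \<in> V" by (simp add: V_def)
    qed
    with A show "\<exists>T. open T \<and> y \<in> T \<and> T \<subseteq> V" by blast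
  qed
  moreover have "U \<inter> V = {}"
  proof (rule ccontr)
    assume "U \<inter> V \<noteq> {}"
    then obtain y where "\<forall>\<^sub>F z in at y. g z = 0" "\<forall>\<^sub>F z in at y. g z \<noteq> 0"
      by (auto simp: U_def V_def eventually_nhds_conv_at)
    hence "\<forall>\<^sub>F z in at y. False" by eventually_elim auto
    thus False by simp
  qed
  moreover have "S \<subseteq> U \<union> V"
  proof
    fix y assume "y \<in> S"
    then obtain F where F: "(\<lambda>h. g (y + h)) has_fps_expansion F"
      using ana by (auto simp: real_analytic_on_def)
    show "y \<in> U \<union> V"
    proof (cases "F = 0")
      case True
      with F have "\<forall>\<^sub>F h in nhds 0. g (y + h) = 0"
        by (auto simp: has_fps_expansion_def)
      moreover have "nhds y = filtermap (\<lambda>h. h + y) (nhds 0)"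
        using filtermap_nhds_shift[of "- y" 0] by simp
      ultimately have "\<forall>\<^sub>F z in nhds y. g z = 0"
        by (simp add: eventually_filtermap add.commute)
      thus ?thesis by (simp add: U_def)
    next
      case False
      with fps_expansion_isolated_zeros[OF F] show ?thesis by (simp add: V_def)
    qed
  qed
  moreover have "x0 \<in> U" using zero by (simp add: U_def)
  ultimately have "x \<in> U"
    using S connectedD[OF S(1), of U V] by blast
  thus ?thesis by (auto simp: U_def dest: eventually_nhds_x_imp_x)
qed

lemma real_analytic_on_diff:
  "real_analytic_on f S \<Longrightarrow> real_analytic_on g S \<Longrightarrow> real_analytic_on (\<lambda>x. f x - g x) S"
  unfolding real_analytic_on_def by (metis has_fps_expansion_diff)

text \<open>
  Re-expansion around another centre is obtained from complex analysis: the series with the same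
  coefficients is holomorphic on the complex disc, and the real parts of its Taylor
  coefficients at a real point expand the real function.
\<close>
lemma real_analytic_on_eval_fps:
  fixes F :: "real fps"
  assumes rad: "fps_conv_radius F \<ge> ereal R"
  shows "real_analytic_on (eval_fps F) {-R<..<R}"
  unfolding real_analytic_on_def
proof
  fix x assume x: "x \<in> {-R<..<R}"
  define FC where "FC = Abs_fps (\<lambda>n. complex_of_real (fps_nth F n))"
  have radC: "fps_conv_radius FC = fps_conv_radius F"
    unfolding fps_conv_radius_def FC_def
    by (subst (1 2) conv_radius_norm [symmetric]) simp
  have of_real: "eval_fps FC (of_real y) = of_real (eval_fps F y)" if "\<bar>y\<bar> < R" for y
  proof -
    have "(\<lambda>n. fps_nth F n * y ^ n) sums eval_fps F y"
      using that by (intro sums_eval_fps less_le_trans[OF _ rad]) simp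
    hence "(\<lambda>n. complex_of_real (fps_nth F n * y ^ n)) sums of_real (eval_fps F y)"
      by (rule sums_of_real)
    thus ?thesis
      by (simp add: eval_fps_def FC_def sums_iff)
  qed
  define r where "r = R - \<bar>x\<bar>"
  have r: "r > 0" using x by (auto simp: r_def)
  have hol: "eval_fps FC holomorphic_on eball (of_real x) r"
  proof (rule holomorphic_on_eval_fps, rule subsetI)
    fix z assume "z \<in> eball (complex_of_real x) r"
    hence "norm (z - of_real x) < R - \<bar>x\<bar>"
      by (simp add: r_def dist_norm norm_minus_commute)
    moreover have "norm z \<le> norm (z - of_real x) + \<bar>x\<bar>"
      using norm_triangle_sub[of z "of_real x"] by simp
    ultimately have "norm z < R" by linarith
    thus "z \<in> eball 0 (fps_conv_radius FC)"
      using rad by (simp add: radC less_le_trans[of "ereal (norm z)" "ereal R"])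
  qed
  define G where "G = fps_expansion (eval_fps FC) (of_real x)"
  have radG: "fps_conv_radius G \<ge> r"
    unfolding G_def by (rule conv_radius_fps_expansion[OF hol])
  define H where "H = Abs_fps (\<lambda>n. Re (fps_nth G n))"
  have sumsH: "(\<lambda>n. fps_nth H n * h ^ n) sums eval_fps F (x + h)" if h: "\<bar>h\<bar> < r" for h
  proof -
    have "(\<lambda>n. fps_nth G n * of_real h ^ n) sums eval_fps G (of_real h)"
      using h by (intro sums_eval_fps less_le_trans[OF _ radG]) simp
    also have "eval_fps G (of_real h) = eval_fps FC (of_real (x + h))"
      using eval_fps_expansion[OF hol, of "of_real (x + h)"] h by (simp add: G_def dist_norm)
    also have "\<dots> = of_real (eval_fps F (x + h))"
      using h by (intro of_real) (auto simp: r_def)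
    finally have "(\<lambda>n. Re (fps_nth G n * of_real h ^ n)) sums Re (of_real (eval_fps F (x + h)))"
      by (rule sums_Re)
    thus ?thesis
      by (simp add: H_def flip: of_real_power)
  qed
  have "fps_conv_radius H \<ge> ereal r"
    unfolding fps_conv_radius_def
    by (rule conv_radius_geI_ex') (use sumsH in \<open>auto simp: sums_iff\<close>)
  hence "fps_conv_radius H > 0"
    using r by (metis ereal_less(2) less_le_trans)
  moreover have "\<forall>\<^sub>F h in nhds 0. h \<in> ball 0 r"
    using r by (intro eventually_nhds_in_open) auto
  hence "\<forall>\<^sub>F h in nhds 0. eval_fps H h = eval_fps F (x + h)"
    by eventually_elim (use sumsH in \<open>auto simp: eval_fps_def sums_iff\<close>)
  ultimately show "\<exists>H. (\<lambda>h. eval_fps F (x + h)) has_fps_expansion H"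
    unfolding has_fps_expansion_def by blast
qed

text \<open>
  Real-analyticity gives no lower bound for the radius of the expansion at 0, so agreement on the
  whole interval has to come from the identity theorem.
\<close>
lemma real_analytic_eq_eval_fps:
  assumes ana: "real_analytic_on f {-R<..<R}" and F: "f has_fps_expansion F"
    and rad: "fps_conv_radius F \<ge> ereal R" and x: "\<bar>x\<bar> < R"
  shows "f x = eval_fps F x"
proof -
  have "f x - eval_fps F x = 0"
  proof (rule real_analytic_identity[of "\<lambda>x. f x - eval_fps F x" "{-R<..<R}" 0])
    show "real_analytic_on (\<lambda>x. f x - eval_fps F x) {-R<..<R}"
      by (intro real_analytic_on_diff ana real_analytic_on_eval_fps rad)
    show "\<forall>\<^sub>F y in nhds 0. f y - eval_fps F y = 0"
      using F by (auto simp: has_fps_expansion_def elim: eventually_mono)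
  qed (use x in auto)
  thus ?thesis by simp
qed

text \<open>
  A version for arbitrary normed fields of the complex fact \<open>fps_nth_fps_expansion\<close>, proved by
  differentiating the expansion repeatedly.
\<close>
lemma has_fps_expansion_higher_deriv_0:
  fixes f :: "'a :: {banach, real_normed_field} \<Rightarrow> 'a"
  assumes "f has_fps_expansion F"
  shows "(deriv ^^ n) f 0 = fact n * fps_nth F n"
  using assms
proof (induction n arbitrary: f F)
  case 0
  thus ?case
    by (auto simp: has_fps_expansion_def eval_fps_at_0 dest: eventually_nhds_x_imp_x)
next
  case (Suc n)
  have "(deriv ^^ Suc n) f 0 = (deriv ^^ n) (deriv f) 0"
    by (simp add: funpow_swap1)
  also have "\<dots> = fact n * fps_nth (fps_deriv F) n"
    by (intro Suc.IH has_fps_expansion_deriv Suc.prems)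
  finally show ?case by (simp add: algebra_simps)
qed

section \<open>Periodic coefficients and agiles\<close>

lemma summable_ln_progression:
  fixes q :: real
  assumes q: "0 < q" "q < 1" and T: "T > 0" and j: "j > 0"
  shows "summable (\<lambda>n. ln (1 - q ^ (n * T + j)))"
proof (rule summable_comparison_test')
  show "summable (\<lambda>n. q ^ n / (1 - q))"
    using q by (intro summable_divide summable_geometric) auto
  fix n :: nat
  have "q ^ (n * T + j) \<le> q ^ 1"
    using q j by (intro power_decreasing) auto
  hence "\<bar>ln (1 - q ^ (n * T + j))\<bar> \<le> q ^ (n * T + j) / (1 - q)"
    using q by (intro ln_one_minus_bound) auto
  also have "n * 1 \<le> n * T" using T by (intro mult_left_mono) auto
  hence "q ^ (n * T + j) \<le> q ^ n"
    using q by (intro power_decreasing trans_le_add1) auto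
  hence "q ^ (n * T + j) / (1 - q) \<le> q ^ n / (1 - q)"
    using q by (intro divide_right_mono) auto
  finally show "norm (ln (1 - q ^ (n * T + j))) \<le> q ^ n / (1 - q)"
    by simp
qed

definition log_progression :: "nat \<Rightarrow> nat \<Rightarrow> real \<Rightarrow> real" where
  "log_progression j T q = (\<Sum>n. ln (1 - q ^ (n * T + j)))"

text \<open>
  The exponents in the two factors of the agile run through the residue classes of j and T - j, so
  the agile is the product of exponentials of two such sums.
\<close>
lemma agile_eq_exp_log_progression:
  fixes q :: real
  assumes q: "0 < q" "q < 1" and j: "0 < j" "j < T"
  shows "agile (real j) (real T) q = exp (log_progression j T q + log_progression (T - j) T q)"
proof -
  have sm: "summable (\<lambda>n. ln (1 - q ^ (n * T + i)))" if "i > 0" for i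
    using q j that by (intro summable_ln_progression) auto
  have factor: "exp (ln (1 - q ^ (n * T + i))) = 1 - q ^ (n * T + i)" if "i > 0" for n i
    using q that by (subst exp_ln) (auto simp: power_less_one_iff)
  have "agile (real j) (real T) q =
          (\<Prod>n. exp (ln (1 - q ^ (n * T + j)) + ln (1 - q ^ (n * T + (T - j)))))"
    unfolding agile_def
  proof (rule prodinf_cong)
    fix n
    have e: "real T * real n + real j = real (n * T + j)"
            "real T * real n + real T - real j = real (n * T + (T - j))"
      using j by (simp_all add: of_nat_diff)
    show "(1 - q powr (real T * real n + real j)) * (1 - q powr (real T * real n + real T - real j)) =
            exp (ln (1 - q ^ (n * T + j)) + ln (1 - q ^ (n * T + (T - j))))"
      unfolding e powr_realpow[OF q(1)] exp_add using j by (simp only: factor zero_less_diff)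
  qed
  also have "\<dots> = exp (log_progression j T q + log_progression (T - j) T q)"
    unfolding log_progression_def
    using j summable_add[OF sm[of j] sm[of "T - j"]] suminf_add[OF sm[of j] sm[of "T - j"]]
    by (simp only: prodinf_exp zero_less_diff)
  finally show ?thesis .
qed

text \<open>
  The series converges, so it may be summed in blocks of length T; the coefficients are the same in
  every block.
\<close>
lemma periodic_log_sum:
  fixes a :: "nat \<Rightarrow> real" and q :: real
  assumes q: "0 < q" "q < 1" and per: "periodic_seq T a"
    and s: "(\<lambda>m. a (Suc m) * ln (1 - q ^ Suc m)) sums s"
  shows "s = (\<Sum>j=1..T. a j * log_progression j T q)"
proof -
  have T: "T > 0"
    using per by (simp add: periodic_seq_def)
  have shift: "a (Suc (n * T + i)) = a (Suc i)" for n i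
    using per[unfolded periodic_seq_def, THEN conjunct2, rule_format, of "Suc i" n]
    by (simp add: add.commute)
  have "(\<lambda>n. \<Sum>m\<in>{n * T..<n * T + T}. a (Suc m) * ln (1 - q ^ Suc m)) sums s"
    using sums_group[OF s T] .
  also have "(\<lambda>n. \<Sum>m\<in>{n * T..<n * T + T}. a (Suc m) * ln (1 - q ^ Suc m)) =
             (\<lambda>n. \<Sum>i<T. a (Suc i) * ln (1 - q ^ (n * T + Suc i)))"
  proof
    fix n
    show "(\<Sum>m\<in>{n * T..<n * T + T}. a (Suc m) * ln (1 - q ^ Suc m)) =
             (\<Sum>i<T. a (Suc i) * ln (1 - q ^ (n * T + Suc i)))"
      by (rule sum.reindex_bij_witness[of _ "\<lambda>i. n * T + i" "\<lambda>m. m - n * T"])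
         (use shift[of n] in \<open>auto simp: le_iff_add\<close>)
  qed
  finally have "(\<lambda>n. \<Sum>i<T. a (Suc i) * ln (1 - q ^ (n * T + Suc i))) sums s" .
  moreover have "(\<lambda>n. \<Sum>i<T. a (Suc i) * ln (1 - q ^ (n * T + Suc i))) sums
                   (\<Sum>i<T. a (Suc i) * log_progression (Suc i) T q)"
    unfolding log_progression_def
    by (intro sums_sum sums_mult summable_sums summable_ln_progression q T) auto
  ultimately have "s = (\<Sum>i<T. a (Suc i) * log_progression (Suc i) T q)"
    by (rule sums_unique2)
  also have "\<dots> = (\<Sum>j=1..T. a j * log_progression j T q)"
    by (rule sum.reindex_bij_witness[of _ "\<lambda>j. j - 1" Suc]) auto
  finally show ?thesis .
qed

lemma periodic_seq_bounded:
  assumes "periodic_seq T a"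
  obtains M where "\<And>d. d \<ge> 1 \<Longrightarrow> \<bar>a d\<bar> \<le> M"
proof (rule that)
  fix d :: nat assume d: "d \<ge> 1"
  have T: "T > 0" using assms by (simp add: periodic_seq_def)
  \<comment> \<open>The representative of d in one period is taken in \<open>{1..T}\<close>, since a is periodic only from index 1 on.\<close>
  have "d = Suc ((d - 1) mod T) + (d - 1) div T * T"
    using d by (metis Suc_pred' add.commute add_Suc_right div_mult_mod_eq less_eq_Suc_le One_nat_def)
  hence "a d = a (Suc ((d - 1) mod T))"
    using assms by (metis periodic_seq_def le_add1 plus_1_eq_Suc)
  also have "\<bar>\<dots>\<bar> \<le> (\<Sum>j<T. \<bar>a (Suc j)\<bar>)"
    using T by (intro member_le_sum[of "(d - 1) mod T" _ "\<lambda>j. \<bar>a (Suc j)\<bar>"]) auto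
  finally show "\<bar>a d\<bar> \<le> (\<Sum>j<T. \<bar>a (Suc j)\<bar>)" .
qed

lemma catoptric_mirror:
  assumes "catoptric T a" "0 < j" "j < T"
  shows "a (T - j) = a j"
proof -
  consider "2 * j < T" | "2 * j = T" | "2 * j > T" by linarith
  thus ?thesis
  proof cases
    case 1
    hence "j \<in> {1..(T - 1) div 2}" using assms by auto
    thus ?thesis using assms(1) by (auto simp: catoptric_def)
  next
    case 2
    thus ?thesis by (simp flip: 2)
  next
    case 3
    hence "T - j \<in> {1..(T - 1) div 2}" using assms by auto
    hence "a (T - j) = a (T - (T - j))" using assms(1) unfolding catoptric_def by blast
    thus ?thesis using assms by simp
  qed
qed

lemma sum_mirror:
  fixes w :: "nat \<Rightarrow> real"
  shows "(\<Sum>j=1..<T. w (T - j)) = (\<Sum>j=1..<T. w j)"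
  by (rule sum.reindex_bij_witness[of _ "\<lambda>j. T - j" "\<lambda>j. T - j"]) auto

text \<open>
  Folding at T/2: only the fixed point of the reflection, present for even T, has no partner.
\<close>
lemma sum_fold_mirror:
  fixes w :: "nat \<Rightarrow> real"
  assumes sym: "\<And>j. 0 < j \<Longrightarrow> j < T \<Longrightarrow> w (T - j) = w j" and T: "T > 0"
    and mid: "even T \<Longrightarrow> w (T div 2) = 0"
  shows "(\<Sum>j=1..<T. w j) = 2 * (\<Sum>j=1..(T - 1) div 2. w j)"
proof -
  let ?m = "(T - 1) div 2"
  have "(\<Sum>j=1..<T. w j) = (\<Sum>j\<in>{1..?m} \<union> {T - ?m..<T}. w j)"
  proof (rule sum.mono_neutral_right)
    show "\<forall>i\<in>{1..<T} - ({1..?m} \<union> {T - ?m..<T}). w i = 0"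
    proof
      fix i assume i: "i \<in> {1..<T} - ({1..?m} \<union> {T - ?m..<T})"
      \<comment> \<open>Outside both halves only the midpoint of an even period remains.\<close>
      hence "T = 2 * i" by (auto; presburger)
      thus "w i = 0" using mid by simp
    qed
  qed (use T in auto)
  also have "\<dots> = (\<Sum>j\<in>{1..?m}. w j) + (\<Sum>j\<in>{T - ?m..<T}. w j)"
    by (rule sum.union_disjoint) auto
  also have "(\<Sum>j\<in>{T - ?m..<T}. w j) = (\<Sum>j\<in>{1..?m}. w j)"
    by (rule sum.reindex_bij_witness[of _ "\<lambda>j. T - j" "\<lambda>j. T - j"])
       (use sym in auto)
  finally show ?thesis by simp
qed

section \<open>Algebraic values of the exponential\<close>

text \<open>
  With \<open>\<Gamma>(d) = (d - 1)!\<close>, the quotient in the definition of X is d times the d-th Taylor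
  coefficient, so \<open>n X(n)\<close> is a Dirichlet convolution with the Moebius function.
\<close>
lemma taylor_coeff_divisor_sum:
  assumes F: "f has_fps_expansion F" and n: "n > 0"
  shows "real n * fps_nth F n = (\<Sum>d | d dvd n. real d * X f d)"
proof (rule moebius_inversion[OF _ n])
  fix m :: nat assume m: "m > 0"
  have deriv: "(deriv ^^ d) f 0 / Gamma (real d) = real d * fps_nth F d" if d: "d > 0" for d
  proof -
    obtain k where k: "d = Suc k" using d by (cases d) auto
    have "Gamma (real d) = fact k"
      using Gamma_fact[of k, where ?'a = real] by (simp add: k)
    thus ?thesis
      by (simp add: has_fps_expansion_higher_deriv_0[OF F] k del: funpow.simps)
  qed
  have "real m * X f m = (\<Sum>d | d dvd m. (deriv ^^ d) f 0 / Gamma (real d) * of_int (moebius (m div d)))"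
    using m by (simp add: X_def)
  also have "\<dots> = (\<Sum>d | d dvd m. real d * fps_nth F d * of_int (moebius (m div d)))"
    by (intro sum.cong refl arg_cong2[of _ _ _ _ "(*)"] deriv) (use m in \<open>auto intro: dvd_pos_nat\<close>)
  finally show "real m * X f m = (\<Sum>d | d dvd m. real d * fps_nth F d * of_int (moebius (m div d)))" .
qed

lemma nome_bounds: "r > 0 \<Longrightarrow> 0 < nome r \<and> nome r < 1"
  by (simp add: nome_def)

text \<open>
  The logarithmic form of f. The rearranged double series is used twice: at every radius below 1 it
  shows that the Taylor series converges, and at q it evaluates that series.
\<close>
lemma log_expansion:
  assumes ana: "real_analytic_on f {-1<..<1}" and per: "periodic_seq T (X f)"
    and q: "0 < q" "q < 1"
  shows "f q = f 0 - (\<Sum>j=1..T. X f j * log_progression j T q)"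
proof -
  obtain F where F: "f has_fps_expansion F"
    using ana[unfolded real_analytic_on_def, rule_format, of 0] by auto
  obtain M where M: "\<And>d. d \<ge> 1 \<Longrightarrow> \<bar>X f d\<bar> \<le> M"
    using periodic_seq_bounded[OF per] by blast
  have coeff: "real n * fps_nth F n = (\<Sum>d | d dvd n. real d * X f d)" if "n \<ge> 1" for n
    using that by (intro taylor_coeff_divisor_sum F) auto
  have "summable (\<lambda>n. fps_nth F n * of_real r ^ n)" if r: "0 < r" "r < 1" for r
  proof -
    obtain s where "(\<lambda>n. fps_nth F (Suc n) * r ^ Suc n) sums s"
      by (rule lambert_log_sums[OF r M coeff])
    thus ?thesis
      using summable_Suc_iff[of "\<lambda>n. fps_nth F n * r ^ n"] by (simp add: sums_iff)
  qed
  hence rad: "fps_conv_radius F \<ge> ereal 1"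
    unfolding fps_conv_radius_def by (intro conv_radius_geI_ex') auto
  obtain s where s: "(\<lambda>n. fps_nth F (Suc n) * q ^ Suc n) sums s"
    "(\<lambda>n. X f (Suc n) * ln (1 - q ^ Suc n)) sums - s"
    by (rule lambert_log_sums[OF q M coeff])
  have "f q = eval_fps F q"
    using q by (intro real_analytic_eq_eval_fps[OF ana F rad]) auto
  moreover have "(\<lambda>n. fps_nth F n * q ^ n) sums (s + fps_nth F 0)"
    using s(1) by (subst (asm) sums_Suc_iff) simp
  hence "eval_fps F q = s + fps_nth F 0"
    by (simp add: eval_fps_def sums_iff)
  moreover have "fps_nth F 0 = f 0"
    using has_fps_expansion_higher_deriv_0[OF F, of 0] by simp
  moreover have "- s = (\<Sum>j=1..T. X f j * log_progression j T q)"
    by (rule periodic_log_sum[OF q per s(2)])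
  ultimately show ?thesis by simp
qed

text \<open>
  The symmetry of X allows each \<open>X(j)\<close> to be split evenly between the residues j and T - j. The class
  j = T, which belongs to no agile, carries the coefficient \<open>X(T) = 0\<close>.
\<close>
lemma exp_minus_eq_prod_agile:
  assumes ana: "real_analytic_on f {-1<..<1}" and per: "periodic_seq T (X f)"
    and cat: "catoptric T (X f)" and q: "0 < q" "q < 1"
  shows "exp (- f q) = exp (- f 0) * (\<Prod>j=1..<T. agile (real j) (real T) q powr (X f j / 2))"
proof -
  define L where "L = (\<lambda>j. log_progression j T q)"
  have T: "T > 0" using per by (simp add: periodic_seq_def)
  have "(\<Sum>j=1..T. X f j * L j) = (\<Sum>j=1..<T. X f j * L j)"
    using T cat by (intro sum.mono_neutral_right) (auto simp: catoptric_def not_less)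
  also have "\<dots> = ((\<Sum>j=1..<T. X f j * L j) + (\<Sum>j=1..<T. X f (T - j) * L (T - j))) / 2"
    unfolding sum_mirror[of "\<lambda>j. X f j * L j"] by simp
  also have "\<dots> = (\<Sum>j=1..<T. X f j / 2 * (L j + L (T - j)))"
    by (simp add: sum_divide_distrib algebra_simps add_divide_distrib catoptric_mirror[OF cat] flip: sum.distrib)
  finally have "- f q = - f 0 + (\<Sum>j=1..<T. X f j / 2 * (L j + L (T - j)))"
    using log_expansion[OF ana per q] by (simp add: L_def)
  hence "exp (- f q) = exp (- f 0) * (\<Prod>j=1..<T. exp (X f j / 2 * (L j + L (T - j))))"
    by (simp only: exp_add exp_sum finite_atLeastLessThan)
  also have "(\<Prod>j=1..<T. exp (X f j / 2 * (L j + L (T - j)))) =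
             (\<Prod>j=1..<T. agile (real j) (real T) q powr (X f j / 2))"
    using q by (intro prod.cong)
      (auto simp: agile_eq_exp_log_progression L_def exp_powr_real mult.commute)
  finally show ?thesis .
qed

theorem mainTheorem1:
  fixes f :: "real \<Rightarrow> real" and T :: nat
  assumes C: "\<forall>a p r :: real. a \<in> \<rat> \<and> p \<in> \<rat> \<and> r \<in> \<rat> \<and> 0 < a \<and> a < p \<and> 0 < r \<longrightarrow>
      algebraic (nome r powr (p / 12 - a / 2 + a\<^sup>2 / (2 * p)) * agile a p (nome r))"
    and analytic: "real_analytic_on f {-1<..<1}"
    and const_term: "algebraic (exp (f 0))"
    and periodic: "periodic_seq T (X f)"
    and rational: "\<forall>n\<ge>1. X f n \<in> \<rat>"
    and catoptric: "catoptric T (X f)"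
  shows "\<exists>A::real. A \<in> \<rat> \<and>
      (\<forall>r::real. r \<in> \<rat> \<and> 0 < r \<longrightarrow> algebraic (nome r powr A * exp (- f (nome r)))) \<and>
      ((even T \<longrightarrow> X f (T div 2) = 0) \<longrightarrow>
        A = (\<Sum>j = 1..(T - 1) div 2.
              (- (real j / 2) + (real j)\<^sup>2 / (2 * real T) + real T / 12) * X f j))"
proof -
  define \<kappa> where "\<kappa> = (\<lambda>j. real T / 12 - real j / 2 + (real j)\<^sup>2 / (2 * real T))"
  define A where "A = (\<Sum>j=1..<T. \<kappa> j * (X f j / 2))"
  have T: "T > 0" using periodic by (simp add: periodic_seq_def)
  have summand: "\<kappa> j * (X f j / 2) \<in> \<rat>" if "j \<in> {1..<T}" for j
    using rational that unfolding \<kappa>_def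
    by (intro Rats_mult Rats_add Rats_diff Rats_divide Rats_power) auto
  have rat: "A \<in> \<rat>"
    unfolding A_def by (rule Rats_sum) (rule summand)
  have alg: "algebraic (nome r powr A * exp (- f (nome r)))" if r: "r \<in> \<rat>" "0 < r" for r
  proof -
    define q where "q = nome r"
    have q: "0 < q" "q < 1" using nome_bounds[OF r(2)] by (simp_all add: q_def)
    have pos: "agile (real j) (real T) q > 0" if "j \<in> {1..<T}" for j
      using that q by (simp add: agile_eq_exp_log_progression)
    have "q powr A * exp (- f q) = inverse (exp (f 0)) *
            (\<Prod>j=1..<T. q powr (\<kappa> j * (X f j / 2)) * agile (real j) (real T) q powr (X f j / 2))"
      unfolding exp_minus_eq_prod_agile[OF analytic periodic catoptric q] A_def
      using q by (simp add: powr_sum prod.distrib exp_minus)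
    also have "\<dots> = inverse (exp (f 0)) *
            (\<Prod>j=1..<T. (q powr \<kappa> j * agile (real j) (real T) q) powr (X f j / 2))"
      using q pos by (simp add: powr_mult powr_powr less_imp_le)
    finally have eq: "q powr A * exp (- f q) = inverse (exp (f 0)) *
            (\<Prod>j=1..<T. (q powr \<kappa> j * agile (real j) (real T) q) powr (X f j / 2))" .
    have "algebraic ((q powr \<kappa> j * agile (real j) (real T) q) powr (X f j / 2))"
      if j: "j \<in> {1..<T}" for j
    proof (rule algebraic_powr_Rats)
      have "real T / 12 - real j / 2 + (real j)\<^sup>2 / (2 * real T) = \<kappa> j"
        by (simp add: \<kappa>_def)
      thus "algebraic (q powr \<kappa> j * agile (real j) (real T) q)"
        using C[rule_format, of "real j" "real T" r] j r by (simp add: q_def)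
      show "0 < q powr \<kappa> j * agile (real j) (real T) q"
        using q pos[OF j] by simp
      show "X f j / 2 \<in> \<rat>"
        using rational j by (intro Rats_divide) auto
    qed
    hence "algebraic (\<Prod>j=1..<T. (q powr \<kappa> j * agile (real j) (real T) q) powr (X f j / 2))"
      by (rule algebraic_prod)
    with algebraic_inverse[OF const_term] have "algebraic (q powr A * exp (- f q))"
      unfolding eq by (rule algebraic_times)
    thus ?thesis by (simp add: q_def)
  qed
  have val: "A = (\<Sum>j = 1..(T - 1) div 2.
      (- (real j / 2) + (real j)\<^sup>2 / (2 * real T) + real T / 12) * X f j)"
    if mid: "even T \<longrightarrow> X f (T div 2) = 0"
  proof -
    have "A = 2 * (\<Sum>j=1..(T - 1) div 2. \<kappa> j * (X f j / 2))"
      unfolding A_def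
    proof (rule sum_fold_mirror)
      fix j assume j: "0 < j" "j < T"
      have "\<kappa> (T - j) = \<kappa> j"
        using j by (simp add: \<kappa>_def of_nat_diff power2_diff add_divide_distrib diff_divide_distrib)
          (simp add: field_simps power2_eq_square)
      thus "\<kappa> (T - j) * (X f (T - j) / 2) = \<kappa> j * (X f j / 2)"
        using catoptric_mirror[OF catoptric j] by simp
    qed (use T mid in auto)
    thus ?thesis
      by (simp add: \<kappa>_def sum_distrib_left algebra_simps)
  qed
  show ?thesis
    using rat alg val by (intro exI[of _ A] conjI allI impI) simp_all
qed

end
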